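(* Let $M^2_1$ be a Lorentz surface of general type in $\mathbb{E}^4_2$ with geometric functions $\nu_1,\nu_2,\lambda,\mu$. Then $M^2_1$ has constant Gauss curvature if and only if the function $\lambda^2-\mu^2-\nu_1\nu_2$ is constant.
   Context: $\mathbb{E}^4_2$ is $\mathbb{R}^4$ with the standard orientation and the metric $\langle\cdot,\cdot\rangle=dx_1^2+dx_2^2-dx_3^2-dx_4^2$; $\nabla'$ is its Levi-Civita connection. A Lorentz surface $M^2_1:z=z(u,v)$, $(u,v)$ in a (connected) domain of $\mathbb{R}^2$, is a smooth immersed surface whose induced metric has signature $(1,1)$. $\sigma$ is its second fundamental form (normal part of $\nabla'_XY$), and $H=\frac12\operatorname{tr}\sigma=\frac12(\sigma(x,x)-\sigma(y,y))$ for tangent orthonormal $x,y$ with $\langle x,x\rangle=1$, $\langle y,y\rangle=-1$. Write $E=\langle z_u,z_u\rangle>0$, $F=\langle z_u,z_v\rangle$, $G=\langle z_v,z_v\rangle<0$ (parameters are always taken with these signs), $W=\sqrt{|EG-F^2|}$. For a normal frame $n_1,n_2$ with $\langle n_1,n_1\rangle=1$, $\langle n_2,n_2\rangle=-1$, $\langle n_1,n_2\rangle=0$ put $c_{11}^k=\langle z_{uu},n_k\rangle$, $c_{12}^k=\langle z_{uv},n_k\rangle$, $c_{22}^k=\langle z_{vv},n_k\rangle$, $\Delta_1=c_{11}^1c_{12}^2-c_{12}^1c_{11}^2$, $\Delta_2=c_{11}^1c_{22}^2-c_{22}^1c_{11}^2$, $\Delta_3=c_{12}^1c_{22}^2-c_{22}^1c_{12}^2$,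 $L=2\Delta_1/W$, $M=\Delta_2/W$, $N=2\Delta_3/W$, $k=\frac{LN-M^2}{EG-F^2}$, $\varkappa=\frac{EN+GL-2FM}{2(EG-F^2)}$. A Lorentz surface of general type is one that is free of flat points, i.e. $(L,M,N)\ne(0,0,0)$ everywhere, satisfies $\varkappa^2-k>0$ everywhere, and whose mean curvature vector $H$ is at each point non-zero and either spacelike ($\langle H,H\rangle>0$) or timelike ($\langle H,H\rangle<0$). Set $\varepsilon=\operatorname{sign}\langle H,H\rangle$. Parameters are principal if $F=0$ and $M=0$; since $\varkappa^2-k>0$, the surface is assumed parametrized by principal parameters. Put $x=z_u/\sqrt{E}$, $y=z_v/\sqrt{-G}$, $b=\varepsilon H/\sqrt{\varepsilon\langle H,H\rangle}$ (so $\langle b,b\rangle=\varepsilon$), and let $l$ be the normal field with $\langle l,l\rangle=-\varepsilon$, $\langle b,l\rangle=0$, such that $(x,y,b,l)$ is positively oriented if $\varepsilon=1$ and $(x,y,l,b)$ is positively oriented if $\varepsilon=-1$. The geometric functions are $\nu_1=\langle\sigma(x,x),b\rangle$, $\nu_2=\langle\sigma(y,y),b\rangle$, $\lambda=\langle\sigma(x,y),b\rangle$, $\mu=\langle\sigma(x,y),l\rangle$. The Gauss curvature is $K=\frac{\langle\sigma(x,x),\sigma(y,y)\rangle-\langle\sigma(x,y),\sigma(x,y)\rangle}{\langle x,x\rangle\langle y,y\rangle-\langle x,y\rangle^2}$. *)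

theory Defs
  imports "HOL-Analysis.Analysis"
begin

section \<open>The pseudo-Euclidean space of signature (2,2)\<close>

definition pinner :: "real ^ 4 \<Rightarrow> real ^ 4 \<Rightarrow> real" where
  "pinner v w = v $ 1 * w $ 1 + v $ 2 * w $ 2 - v $ 3 * w $ 3 - v $ 4 * w $ 4"

definition positively_oriented :: "real ^ 4 \<Rightarrow> real ^ 4 \<Rightarrow> real ^ 4 \<Rightarrow> real ^ 4 \<Rightarrow> bool" where
  "positively_oriented v1 v2 v3 v4 \<longleftrightarrow> det (vector [v1, v2, v3, v4] :: real ^ 4 ^ 4) > 0"


section \<open>Smooth maps on a plane domain\<close>

definition du :: "(real \<times> real \<Rightarrow> 'a::real_normed_vector) \<Rightarrow> real \<times> real \<Rightarrow> 'a" where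
  "du f p = frechet_derivative f (at p) (1, 0)"

definition dv :: "(real \<times> real \<Rightarrow> 'a::real_normed_vector) \<Rightarrow> real \<times> real \<Rightarrow> 'a" where
  "dv f p = frechet_derivative f (at p) (0, 1)"

primrec Ck_on :: "nat \<Rightarrow> (real \<times> real) set \<Rightarrow> (real \<times> real \<Rightarrow> 'a::real_normed_vector) \<Rightarrow> bool" where
  "Ck_on 0 D f \<longleftrightarrow> continuous_on D f"
| "Ck_on (Suc k) D f \<longleftrightarrow> (\<forall>p\<in>D. f differentiable (at p)) \<and> Ck_on k D (du f) \<and> Ck_on k D (dv f)"

definition smooth_on :: "(real \<times> real) set \<Rightarrow> (real \<times> real \<Rightarrow> 'a::real_normed_vector) \<Rightarrow> bool" where
  "smooth_on D f \<longleftrightarrow> (\<forall>k. Ck_on k D f)"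


section \<open>Lorentz surfaces\<close>

definition tangent_plane :: "(real \<times> real \<Rightarrow> real ^ 4) \<Rightarrow> real \<times> real \<Rightarrow> (real ^ 4) set" where
  "tangent_plane z p = range (frechet_derivative z (at p))"

definition normal_plane :: "(real \<times> real \<Rightarrow> real ^ 4) \<Rightarrow> real \<times> real \<Rightarrow> (real ^ 4) set" where
  "normal_plane z p = {n. \<forall>t\<in>tangent_plane z p. pinner n t = 0}"

definition orthonormal_tangent_frame ::
    "(real \<times> real \<Rightarrow> real ^ 4) \<Rightarrow> real \<times> real \<Rightarrow> real ^ 4 \<Rightarrow> real ^ 4 \<Rightarrow> bool" where
  "orthonormal_tangent_frame z p X Y \<longleftrightarrow>
     X \<in> tangent_plane z p \<and> Y \<in> tangent_plane z p \<and>
     pinner X X = 1 \<and> pinner Y Y = -1 \<and> pinner X Y = 0"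

definition orthonormal_normal_frame ::
    "(real \<times> real \<Rightarrow> real ^ 4) \<Rightarrow> real \<times> real \<Rightarrow> real ^ 4 \<Rightarrow> real ^ 4 \<Rightarrow> bool" where
  "orthonormal_normal_frame z p n1 n2 \<longleftrightarrow>
     n1 \<in> normal_plane z p \<and> n2 \<in> normal_plane z p \<and>
     pinner n1 n1 = 1 \<and> pinner n2 n2 = -1 \<and> pinner n1 n2 = 0"

definition E_coeff :: "(real \<times> real \<Rightarrow> real ^ 4) \<Rightarrow> real \<times> real \<Rightarrow> real" where
  "E_coeff z p = pinner (du z p) (du z p)"

definition F_coeff :: "(real \<times> real \<Rightarrow> real ^ 4) \<Rightarrow> real \<times> real \<Rightarrow> real" where
  "F_coeff z p = pinner (du z p) (dv z p)"

definition G_coeff :: "(real \<times> real \<Rightarrow> real ^ 4) \<Rightarrow> real \<times> real \<Rightarrow> real" where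
  "G_coeff z p = pinner (dv z p) (dv z p)"

definition W_coeff :: "(real \<times> real \<Rightarrow> real ^ 4) \<Rightarrow> real \<times> real \<Rightarrow> real" where
  "W_coeff z p = sqrt \<bar>E_coeff z p * G_coeff z p - (F_coeff z p)\<^sup>2\<bar>"

text \<open>The existence of an orthonormal tangent frame says that the induced metric has
  signature (1,1). The sign conditions on E and G are the standing normalisation of the
  parameters.\<close>

definition lorentz_surface :: "(real \<times> real \<Rightarrow> real ^ 4) \<Rightarrow> (real \<times> real) set \<Rightarrow> bool" where
  "lorentz_surface z D \<longleftrightarrow>
     open D \<and> connected D \<and> D \<noteq> {} \<and> smooth_on D z \<and>
     (\<forall>p\<in>D. inj (frechet_derivative z (at p))) \<and>
     (\<forall>p\<in>D. \<exists>X Y. orthonormal_tangent_frame z p X Y) \<and>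
     (\<forall>p\<in>D. E_coeff z p > 0 \<and> G_coeff z p < 0)"


section \<open>Second fundamental form\<close>

definition normal_part :: "(real \<times> real \<Rightarrow> real ^ 4) \<Rightarrow> real \<times> real \<Rightarrow> real ^ 4 \<Rightarrow> real ^ 4" where
  "normal_part z p v = (THE n. n \<in> normal_plane z p \<and> v - n \<in> tangent_plane z p)"

text \<open>The flat Levi-Civita connection along the surface: the derivative of the field
  \<open>Y\<close> (a function of the parameters) in the direction of the tangent vector \<open>X\<close> at
  \<open>z p\<close>, pulled back to the parameter plane.\<close>

definition nabla' ::
    "(real \<times> real \<Rightarrow> real ^ 4) \<Rightarrow> real \<times> real \<Rightarrow> real ^ 4 \<Rightarrow> (real \<times> real \<Rightarrow> real ^ 4) \<Rightarrow> real ^ 4" where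
  "nabla' z p X Y = frechet_derivative Y (at p) (inv (frechet_derivative z (at p)) X)"

text \<open>To evaluate the second fundamental form on two tangent vectors at a point, the second
  one has to be extended to a tangent field. The extension used here has constant components
  with respect to the coordinate frame; by \<open>sff_field\<close> below, any other extension gives
  the same value.\<close>

definition coordinate_extension ::
    "(real \<times> real \<Rightarrow> real ^ 4) \<Rightarrow> real \<times> real \<Rightarrow> real ^ 4 \<Rightarrow> real \<times> real \<Rightarrow> real ^ 4" where
  "coordinate_extension z p Y q =
     frechet_derivative z (at q) (inv (frechet_derivative z (at p)) Y)"

definition sff :: "(real \<times> real \<Rightarrow> real ^ 4) \<Rightarrow> real \<times> real \<Rightarrow> real ^ 4 \<Rightarrow> real ^ 4 \<Rightarrow> real ^ 4" where
  "sff z p X Y = normal_part z p (nabla' z p X (coordinate_extension z p Y))"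

text \<open>Half the trace of \<open>sff\<close>; the value does not depend on the orthonormal frame.\<close>

definition mean_curvature_vector :: "(real \<times> real \<Rightarrow> real ^ 4) \<Rightarrow> real \<times> real \<Rightarrow> real ^ 4" where
  "mean_curvature_vector z p =
     (THE h. \<forall>X Y. orthonormal_tangent_frame z p X Y \<longrightarrow>
        h = (1/2) *\<^sub>R (sff z p X X - sff z p Y Y))"


section \<open>Invariants of the second fundamental form\<close>

definition c11 :: "(real \<times> real \<Rightarrow> real ^ 4) \<Rightarrow> real \<times> real \<Rightarrow> real ^ 4 \<Rightarrow> real" where
  "c11 z p n = pinner (du (du z) p) n"

definition c12 :: "(real \<times> real \<Rightarrow> real ^ 4) \<Rightarrow> real \<times> real \<Rightarrow> real ^ 4 \<Rightarrow> real" where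
  "c12 z p n = pinner (dv (du z) p) n"

definition c22 :: "(real \<times> real \<Rightarrow> real ^ 4) \<Rightarrow> real \<times> real \<Rightarrow> real ^ 4 \<Rightarrow> real" where
  "c22 z p n = pinner (dv (dv z) p) n"

context
  fixes z :: "real \<times> real \<Rightarrow> real ^ 4" and p :: "real \<times> real" and n1 n2 :: "real ^ 4"
begin

definition Delta1 :: real where
  "Delta1 = c11 z p n1 * c12 z p n2 - c12 z p n1 * c11 z p n2"

definition Delta2 :: real where
  "Delta2 = c11 z p n1 * c22 z p n2 - c22 z p n1 * c11 z p n2"

definition Delta3 :: real where
  "Delta3 = c12 z p n1 * c22 z p n2 - c22 z p n1 * c12 z p n2"

definition L_coeff :: real where
  "L_coeff = 2 * Delta1 / W_coeff z p"

definition M_coeff :: real where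
  "M_coeff = Delta2 / W_coeff z p"

definition N_coeff :: real where
  "N_coeff = 2 * Delta3 / W_coeff z p"

definition k_inv :: real where
  "k_inv = (L_coeff * N_coeff - M_coeff\<^sup>2)
     / (E_coeff z p * G_coeff z p - (F_coeff z p)\<^sup>2)"

definition varkappa_inv :: real where
  "varkappa_inv = (E_coeff z p * N_coeff + G_coeff z p * L_coeff - 2 * F_coeff z p * M_coeff)
     / (2 * (E_coeff z p * G_coeff z p - (F_coeff z p)\<^sup>2))"

end

text \<open>A change of orthonormal normal frame multiplies \<open>L_coeff\<close>, \<open>M_coeff\<close>, \<open>N_coeff\<close> and
  \<open>varkappa_inv\<close> by a common sign and leaves \<open>k_inv\<close> unchanged, so the conditions below do
  not depend on the choice of \<open>n1\<close>, \<open>n2\<close>.\<close>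

definition general_type :: "(real \<times> real \<Rightarrow> real ^ 4) \<Rightarrow> (real \<times> real) set \<Rightarrow> bool" where
  "general_type z D \<longleftrightarrow>
     lorentz_surface z D \<and>
     (\<forall>p\<in>D. \<forall>n1 n2. orthonormal_normal_frame z p n1 n2 \<longrightarrow>
        (L_coeff z p n1 n2, M_coeff z p n1 n2, N_coeff z p n1 n2) \<noteq> (0, 0, 0) \<and>
        (varkappa_inv z p n1 n2)\<^sup>2 - k_inv z p n1 n2 > 0) \<and>
     (\<forall>p\<in>D. mean_curvature_vector z p \<noteq> 0 \<and>
        (pinner (mean_curvature_vector z p) (mean_curvature_vector z p) > 0 \<or>
         pinner (mean_curvature_vector z p) (mean_curvature_vector z p) < 0))"

definition principal_parameters :: "(real \<times> real \<Rightarrow> real ^ 4) \<Rightarrow> (real \<times> real) set \<Rightarrow> bool" where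
  "principal_parameters z D \<longleftrightarrow>
     (\<forall>p\<in>D. F_coeff z p = 0 \<and>
        (\<forall>n1 n2. orthonormal_normal_frame z p n1 n2 \<longrightarrow> M_coeff z p n1 n2 = 0))"


section \<open>The geometric frame and the geometric functions\<close>

context
  fixes z :: "real \<times> real \<Rightarrow> real ^ 4" and p :: "real \<times> real"
begin

definition frame_x :: "real ^ 4" where
  "frame_x = (1 / sqrt (E_coeff z p)) *\<^sub>R du z p"

definition frame_y :: "real ^ 4" where
  "frame_y = (1 / sqrt (- G_coeff z p)) *\<^sub>R dv z p"

definition eps :: real where
  "eps = sgn (pinner (mean_curvature_vector z p) (mean_curvature_vector z p))"

definition frame_b :: "real ^ 4" where
  "frame_b = (eps / sqrt (eps * pinner (mean_curvature_vector z p) (mean_curvature_vector z p)))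
     *\<^sub>R mean_curvature_vector z p"

definition frame_l :: "real ^ 4" where
  "frame_l = (THE l. l \<in> normal_plane z p \<and> pinner l l = - eps \<and> pinner frame_b l = 0 \<and>
     (if eps = 1 then positively_oriented frame_x frame_y frame_b l
      else positively_oriented frame_x frame_y l frame_b))"

definition nu1 :: real where
  "nu1 = pinner (sff z p frame_x frame_x) frame_b"

definition nu2 :: real where
  "nu2 = pinner (sff z p frame_y frame_y) frame_b"

definition lam :: real where
  "lam = pinner (sff z p frame_x frame_y) frame_b"

definition mu :: real where
  "mu = pinner (sff z p frame_x frame_y) frame_l"

definition gauss_curvature :: real where
  "gauss_curvature =
     (pinner (sff z p frame_x frame_x) (sff z p frame_y frame_y)
        - pinner (sff z p frame_x frame_y) (sff z p frame_x frame_y))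
     / (pinner frame_x frame_x * pinner frame_y frame_y - (pinner frame_x frame_y)\<^sup>2)"

end


section \<open>Independence of the extension\<close>

lemma bounded_bilinear_pinner: "bounded_bilinear pinner"
proof -
  have "bilinear pinner"
    unfolding bilinear_def pinner_def
    by (intro conjI allI linearI) (simp_all add: algebra_simps)
  then show ?thesis by (simp add: bilinear_conv_bounded_bilinear)
qed

lemma lorentz_surface_differentiable:
  assumes "lorentz_surface z D" "p \<in> D"
  shows "z differentiable (at p)" "du z differentiable (at p)" "dv z differentiable (at p)"
proof -
  have "Ck_on (Suc (Suc 0)) D z"
    using assms unfolding lorentz_surface_def smooth_on_def by blast
  then show "z differentiable (at p)" "du z differentiable (at p)" "dv z differentiable (at p)"
    using assms(2) by auto
qed

lemma frechet_derivative_du_dv: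
  assumes "z differentiable (at p)"
  shows "frechet_derivative z (at p) w = fst w *\<^sub>R du z p + snd w *\<^sub>R dv z p"
proof -
  have lin: "linear (frechet_derivative z (at p))"
    using assms by (rule linear_frechet_derivative)
  have w: "w = fst w *\<^sub>R (1, 0) + snd w *\<^sub>R (0, 1)" by (cases w) simp
  show ?thesis
    by (subst w, subst linear_add[OF lin])
       (simp only: linear_cmul[OF lin] du_def dv_def)
qed

text \<open>A tangent field vanishing at a point has tangential derivative there.\<close>

lemma tangent_field_derivative:
  assumes L: "lorentz_surface z D" and p: "p \<in> D"
    and V: "V differentiable (at p)" and tan: "\<And>q. q \<in> D \<Longrightarrow> V q \<in> tangent_plane z q"
    and V0: "V p = 0"
  shows "frechet_derivative V (at p) w \<in> tangent_plane z p"
proof -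
  interpret P: bounded_bilinear pinner by (rule bounded_bilinear_pinner)
  define g where "g q = pinner (du z q) (du z q) * pinner (dv z q) (dv z q)
              - pinner (du z q) (dv z q) * pinner (du z q) (dv z q)" for q
  define \<alpha> where "\<alpha> q = pinner (V q) (du z q) * pinner (dv z q) (dv z q)
              - pinner (V q) (dv z q) * pinner (du z q) (dv z q)" for q
  define \<beta> where "\<beta> q = pinner (V q) (dv z q) * pinner (du z q) (du z q)
              - pinner (V q) (du z q) * pinner (du z q) (dv z q)" for q
  have sym: "pinner (dv z q) (du z q) = pinner (du z q) (dv z q)" for q
    by (simp add: pinner_def algebra_simps)
  have eq: "\<alpha> q *\<^sub>R du z q + \<beta> q *\<^sub>R dv z q = g q *\<^sub>R V q" if q: "q \<in> D" for q
  proof -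
    obtain w where "V q = frechet_derivative z (at q) w"
      using tan[OF q] unfolding tangent_plane_def by blast
    then have Vq: "V q = fst w *\<^sub>R du z q + snd w *\<^sub>R dv z q"
      using frechet_derivative_du_dv[OF lorentz_surface_differentiable(1)[OF L q]] by simp
    have 1: "pinner (V q) (du z q)
        = fst w * pinner (du z q) (du z q) + snd w * pinner (du z q) (dv z q)"
      by (simp add: Vq P.add_left P.scaleR_left sym)
    have 2: "pinner (V q) (dv z q)
        = fst w * pinner (du z q) (dv z q) + snd w * pinner (dv z q) (dv z q)"
      by (simp add: Vq P.add_left P.scaleR_left)
    have a: "\<alpha> q = g q * fst w" unfolding 1 2 \<alpha>_def g_def by (simp add: algebra_simps)
    have b: "\<beta> q = g q * snd w" unfolding 1 2 \<beta>_def g_def by (simp add: algebra_simps)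
    show ?thesis unfolding a b by (simp add: Vq scaleR_add_right)
  qed
  have pd: "(\<lambda>q. pinner (f q) (h q)) differentiable (at p)"
    if f: "f differentiable (at p)" and h: "h differentiable (at p)" for f h
  proof -
    obtain f' where f': "(f has_derivative f') (at p)"
      using f unfolding differentiable_def by (elim exE)
    obtain h' where h': "(h has_derivative h') (at p)"
      using h unfolding differentiable_def by (elim exE)
    show ?thesis using P.FDERIV[OF f' h'] by (rule differentiableI)
  qed
  note zd = lorentz_surface_differentiable[OF L p]
  have "\<alpha> differentiable (at p)" unfolding \<alpha>_def
    by (intro differentiable_diff differentiable_mult pd V zd)
  then obtain \<alpha>' where al: "(\<alpha> has_derivative \<alpha>') (at p)"
    unfolding differentiable_def by (elim exE)
  have "\<beta> differentiable (at p)" unfolding \<beta>_def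
    by (intro differentiable_diff differentiable_mult pd V zd)
  then obtain \<beta>' where be: "(\<beta> has_derivative \<beta>') (at p)"
    unfolding differentiable_def by (elim exE)
  have "g differentiable (at p)" unfolding g_def
    by (intro differentiable_diff differentiable_mult pd zd)
  then obtain g' where g: "(g has_derivative g') (at p)"
    unfolding differentiable_def by (elim exE)
  obtain V' where Vd: "(V has_derivative V') (at p)"
    using V unfolding differentiable_def by (elim exE)
  obtain U' where Ud: "(du z has_derivative U') (at p)"
    using zd(2) unfolding differentiable_def by (elim exE)
  obtain Z' where Zd: "(dv z has_derivative Z') (at p)"
    using zd(3) unfolding differentiable_def by (elim exE)
  have V': "frechet_derivative V (at p) = V'"
    using Vd by (rule frechet_derivative_at[symmetric])
  have 0: "\<alpha> p = 0" "\<beta> p = 0" by (simp_all add: \<alpha>_def \<beta>_def V0 P.zero_left)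
  have "((\<lambda>q. \<alpha> q *\<^sub>R du z q + \<beta> q *\<^sub>R dv z q) has_derivative
      (\<lambda>h. (\<alpha> p *\<^sub>R U' h + \<alpha>' h *\<^sub>R du z p) + (\<beta> p *\<^sub>R Z' h + \<beta>' h *\<^sub>R dv z p))) (at p)"
    by (rule has_derivative_add[OF has_derivative_scaleR[OF al Ud] has_derivative_scaleR[OF be Zd]])
  then have l: "((\<lambda>q. \<alpha> q *\<^sub>R du z q + \<beta> q *\<^sub>R dv z q) has_derivative
      (\<lambda>h. \<alpha>' h *\<^sub>R du z p + \<beta>' h *\<^sub>R dv z p)) (at p)"
    by (simp add: 0)
  have r: "((\<lambda>q. g q *\<^sub>R V q) has_derivative (\<lambda>h. g p *\<^sub>R V' h)) (at p)"
    using has_derivative_scaleR[OF g Vd] by (simp add: V0)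
  have op: "open D" using L by (simp add: lorentz_surface_def)
  have "((\<lambda>q. g q *\<^sub>R V q) has_derivative
      (\<lambda>h. \<alpha>' h *\<^sub>R du z p + \<beta>' h *\<^sub>R dv z p)) (at p)"
    by (rule has_derivative_transform_within_open[OF l op p]) (rule eq)
  then have "(\<lambda>h. \<alpha>' h *\<^sub>R du z p + \<beta>' h *\<^sub>R dv z p) = (\<lambda>h. g p *\<^sub>R V' h)"
    using r by (rule has_derivative_unique)
  then have *: "\<alpha>' w *\<^sub>R du z p + \<beta>' w *\<^sub>R dv z p = g p *\<^sub>R V' w" by (rule fun_cong)
  have "E_coeff z p > 0" "G_coeff z p < 0" using L p by (auto simp: lorentz_surface_def)
  then have "E_coeff z p * G_coeff z p < 0" by (rule mult_pos_neg)
  moreover have "g p = E_coeff z p * G_coeff z p - F_coeff z p * F_coeff z p"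
    by (simp add: g_def E_coeff_def F_coeff_def G_coeff_def)
  moreover have "F_coeff z p * F_coeff z p \<ge> 0" by simp
  ultimately have g0: "g p \<noteq> 0" by linarith
  have "V' w = inverse (g p) *\<^sub>R (g p *\<^sub>R V' w)" using g0 by simp
  also have "\<dots> = (inverse (g p) * \<alpha>' w) *\<^sub>R du z p + (inverse (g p) * \<beta>' w) *\<^sub>R dv z p"
    unfolding *[symmetric] by (simp add: scaleR_add_right)
  also have "\<dots> = frechet_derivative z (at p) (inverse (g p) * \<alpha>' w, inverse (g p) * \<beta>' w)"
    by (simp add: frechet_derivative_du_dv[OF zd(1)])
  finally show ?thesis unfolding V' tangent_plane_def by blast
qed

lemma sff_field:
  assumes L: "lorentz_surface z D" and p: "p \<in> D"
    and Y: "Y differentiable (at p)" and tan: "\<And>q. q \<in> D \<Longrightarrow> Y q \<in> tangent_plane z q"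
  shows "normal_part z p (nabla' z p X Y) = sff z p X (Y p)"
proof -
  define c where "c = coordinate_extension z p (Y p)"
  define w where "w = inv (frechet_derivative z (at p)) (Y p)"
  define h where "h = inv (frechet_derivative z (at p)) X"
  note D = lorentz_surface_differentiable[OF L]
  have cq: "c q = frechet_derivative z (at q) w" for q
    by (simp add: c_def w_def coordinate_extension_def)
  have op: "open D" using L by (simp add: lorentz_surface_def)
  have "(\<lambda>q. fst w *\<^sub>R du z q + snd w *\<^sub>R dv z q) differentiable (at p)"
    by (intro differentiable_add differentiable_scaleR differentiable_const D(2,3)[OF p])
  then obtain c' where
    "((\<lambda>q. fst w *\<^sub>R du z q + snd w *\<^sub>R dv z q) has_derivative c') (at p)"
    unfolding differentiable_def by blast
  then have "(c has_derivative c') (at p)"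
    by (rule has_derivative_transform_within_open[OF _ op p])
       (simp add: cq frechet_derivative_du_dv D(1))
  then have c: "c differentiable (at p)" unfolding differentiable_def by blast
  have lin: "linear (frechet_derivative z (at q))" if "q \<in> D" for q
    using linear_frechet_derivative D(1)[OF that] by blast
  have sub: "a - b \<in> tangent_plane z q" "a + b \<in> tangent_plane z q"
    if "q \<in> D" "a \<in> tangent_plane z q" "b \<in> tangent_plane z q" for a b q
    using that lin[of q] unfolding tangent_plane_def
    by (auto simp: linear_diff[symmetric] linear_add[symmetric])
  have "c p = Y p"
    unfolding cq w_def using tan[OF p] unfolding tangent_plane_def by (rule f_inv_into_f)
  then have "frechet_derivative (\<lambda>q. Y q - c q) (at p) h \<in> tangent_plane z p"
    using sub(1) tan
    by (intro tangent_field_derivative[OF L p] differentiable_diff Y c)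
       (simp_all add: cq tangent_plane_def)
  moreover have "frechet_derivative (\<lambda>q. Y q - c q) (at p)
      = (\<lambda>h. frechet_derivative Y (at p) h - frechet_derivative c (at p) h)"
    by (rule frechet_derivative_at[symmetric], rule has_derivative_diff)
       (use Y c in \<open>simp_all add: frechet_derivative_works[symmetric]\<close>)
  ultimately have t: "nabla' z p X Y - nabla' z p X c \<in> tangent_plane z p"
    by (simp add: nabla'_def h_def)
  have "nabla' z p X Y - n \<in> tangent_plane z p \<longleftrightarrow> nabla' z p X c - n \<in> tangent_plane z p" for n
    using sub(1)[OF p _ t, of "nabla' z p X Y - n"] sub(2)[OF p _ t, of "nabla' z p X c - n"]
    by (auto simp: algebra_simps)
  then show ?thesis by (simp add: sff_def normal_part_def c_def)
qed

end

theory Submission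
  imports Defs
begin

text \<open>
  The equivalence is pointwise: with \<open>\<epsilon> = \<plusminus>1\<close> the causal sign of the mean curvature vector \<open>H\<close>,
  the Gauss curvature is \<open>K = \<epsilon> (\<lambda>\<^sup>2 - \<mu>\<^sup>2 - \<nu>\<^sub>1 \<nu>\<^sub>2)\<close> (lemma \<open>gauss_curvature_eq\<close>).

  The reason is that \<open>\<sigma>(x,x)\<close> and \<open>\<sigma>(y,y)\<close> are both multiples of \<open>b\<close>. Their difference is \<open>2H\<close>,
  which is a non-zero multiple of \<open>b\<close>, so they have the same component along \<open>l\<close> and different
  components along \<open>b\<close>. For orthogonal parameters, \<open>M = 0\<close> says that the two vectors are linearly
  dependent (lemma \<open>M_coeff_eq_0_iff\<close>); these facts are compatible only if the common component
  along \<open>l\<close> vanishes. Expanding the three values of \<open>\<sigma>\<close> in the basis \<open>b, l\<close>, where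
  \<open>\<langle>b,b\<rangle> = \<epsilon>\<close> and \<open>\<langle>l,l\<rangle> = -\<epsilon>\<close>, gives
  \<open>\<langle>\<sigma>(x,x),\<sigma>(y,y)\<rangle> = \<epsilon> \<nu>\<^sub>1 \<nu>\<^sub>2\<close> and \<open>\<langle>\<sigma>(x,y),\<sigma>(x,y)\<rangle> = \<epsilon> (\<lambda>\<^sup>2 - \<mu>\<^sup>2)\<close>,
  and the denominator in the definition of \<open>K\<close> is \<open>-1\<close>.

  It remains to see that \<open>\<epsilon>\<close> does not jump: \<open>\<langle>H,H\<rangle>\<close> is continuous and has no zero on the
  connected domain, hence has constant sign (lemma \<open>eps_constant\<close>).

  The normal part, the mean curvature vector and the field \<open>l\<close> are given by definite descriptions,
  so each of them first needs an explicit witness and a uniqueness proof: the orthogonal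
  projection, a formula in the second derivatives, and a cross product of three vectors.
\<close>

section \<open>Orthonormal bases of the pseudo-Euclidean space\<close>

interpretation pinner: bounded_bilinear pinner
  by (rule bounded_bilinear_pinner)

lemma pinner_commute: "pinner v w = pinner w v"
  by (simp add: pinner_def mult.commute)

lemma vector_4 [simp]:
  "(vector [a, b, c, d] :: 'a::zero ^ 4) $ 1 = a"
  "(vector [a, b, c, d] :: 'a::zero ^ 4) $ 2 = b"
  "(vector [a, b, c, d] :: 'a::zero ^ 4) $ 3 = c"
  "(vector [a, b, c, d] :: 'a::zero ^ 4) $ 4 = d"
  unfolding vector_def by simp_all

text \<open>An orthonormal system of four vectors is a basis: if \<open>A\<close> is the matrix with these rows, the
  orthonormality relations exhibit a right inverse of \<open>A\<close>, namely the transpose of \<open>A\<close> with signs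
  adjusted. So \<open>A\<close> is invertible and the difference of the two sides, being orthogonal to all rows,
  is zero.\<close>

lemma pinner_orthonormal_expansion:
  assumes on: "pinner x x = 1" "pinner y y = -1" "pinner b b = e" "pinner l l = - e"
    "pinner x y = 0" "pinner x b = 0" "pinner x l = 0"
    "pinner y b = 0" "pinner y l = 0" "pinner b l = 0"
    and e: "e = 1 \<or> e = -1"
  shows "v = pinner v x *\<^sub>R x - pinner v y *\<^sub>R y + (e * pinner v b) *\<^sub>R b - (e * pinner v l) *\<^sub>R l"
proof -
  define A :: "real ^ 4 ^ 4" where "A = vector [x, y, b, l]"
  \<comment> \<open>\<open>s\<close> holds the squares of the four vectors, \<open>t\<close> the signs of the ambient metric\<close>
  define s :: "real ^ 4" where "s = vector [1, -1, e, -e]"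
  define t :: "real ^ 4" where "t = vector [1, 1, -1, -1]"
  define B :: "real ^ 4 ^ 4" where "B = (\<chi> k j. t $ k * A $ j $ k * s $ j)"
  have ee: "e * e = 1" using e by auto
  have AB: "(A ** B) $ i $ j = s $ j * pinner (A $ i) (A $ j)" for i j
    by (simp add: matrix_matrix_mult_def sum_4 B_def t_def pinner_def algebra_simps)
  have "A ** B = mat 1"
    unfolding vec_eq_iff AB forall_4
    by (simp add: A_def s_def mat_def on ee pinner_commute[of y x] pinner_commute[of b x]
        pinner_commute[of l x] pinner_commute[of b y] pinner_commute[of l y] pinner_commute[of l b])
  then have "B ** A = mat 1" by (simp add: matrix_left_right_inverse)
  then have ker: "w = 0" if "A *v w = 0" for w
    using that matrix_left_invertible_ker[of A] by blast
  define r where "r = v - (pinner v x *\<^sub>R x - pinner v y *\<^sub>R y + (e * pinner v b) *\<^sub>R b - (e * pinner v l) *\<^sub>R l)"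
  have r: "pinner r (A $ i) = 0" for i
  proof -
    have "pinner r x = 0" "pinner r y = 0" "pinner r b = 0" "pinner r l = 0"
      using on ee unfolding r_def
      by (simp_all add: pinner.diff_left pinner.add_left pinner.scaleR_left pinner_commute[of y x] pinner_commute[of b x]
        pinner_commute[of l x] pinner_commute[of b y] pinner_commute[of l y] pinner_commute[of l b] mult.commute mult.left_commute)
    then have "\<forall>i. pinner r (A $ i) = 0" by (simp add: forall_4 A_def)
    then show ?thesis by blast
  qed
  have "A *v (\<chi> k. t $ k * r $ k) = 0"
    using r by (simp add: vec_eq_iff matrix_vector_mult_def sum_4 t_def pinner_def algebra_simps)
  then have "(\<chi> k. t $ k * r $ k) = 0" by (rule ker)
  then have "r = 0"
    unfolding vec_eq_iff forall_4 by (simp add: t_def)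
  then show ?thesis by (simp add: r_def)
qed

lemma det_4:
  fixes A :: "'a::comm_ring_1 ^ 4 ^ 4"
  shows "det A =
      A$1$1 * (A$2$2 * (A$3$3 * A$4$4 - A$3$4 * A$4$3) - A$2$3 * (A$3$2 * A$4$4 - A$3$4 * A$4$2)
             + A$2$4 * (A$3$2 * A$4$3 - A$3$3 * A$4$2))
    - A$1$2 * (A$2$1 * (A$3$3 * A$4$4 - A$3$4 * A$4$3) - A$2$3 * (A$3$1 * A$4$4 - A$3$4 * A$4$1)
             + A$2$4 * (A$3$1 * A$4$3 - A$3$3 * A$4$1))
    + A$1$3 * (A$2$1 * (A$3$2 * A$4$4 - A$3$4 * A$4$2) - A$2$2 * (A$3$1 * A$4$4 - A$3$4 * A$4$1)
             + A$2$4 * (A$3$1 * A$4$2 - A$3$2 * A$4$1))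
    - A$1$4 * (A$2$1 * (A$3$2 * A$4$3 - A$3$3 * A$4$2) - A$2$2 * (A$3$1 * A$4$3 - A$3$3 * A$4$1)
             + A$2$3 * (A$3$1 * A$4$2 - A$3$2 * A$4$1))"
proof -
  have f1: "finite {2::4, 3, 4}" "1 \<notin> {2::4, 3, 4}" by auto
  have f2: "finite {3::4, 4}" "2 \<notin> {3::4, 4}" by auto
  have f3: "finite {4::4}" "3 \<notin> {4::4}" by auto
  show ?thesis
    unfolding det_def UNIV_4
    unfolding sum_over_permutations_insert[OF f1]
    unfolding sum_over_permutations_insert[OF f2]
    unfolding sum_over_permutations_insert[OF f3]
    unfolding permutes_sing
    by (simp add: sign_swap_id permutation_swap_id permutation_compose sign_compose sign_id swap_id_eq
        algebra_simps)
qed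

text \<open>The cross product of three vectors for the metric of signature (2,2): the entries are the
  cofactors of the last row of a 4 by 4 determinant, with the signs of the metric absorbed, so that
  \<open>pinner (pcross a b c)\<close> is the linear form \<open>w \<mapsto> det (a, b, c, w)\<close>.\<close>

definition pcross :: "real ^ 4 \<Rightarrow> real ^ 4 \<Rightarrow> real ^ 4 \<Rightarrow> real ^ 4" where
  "pcross a b c = vector
    [- (a$2 * (b$3 * c$4 - b$4 * c$3) - a$3 * (b$2 * c$4 - b$4 * c$2) + a$4 * (b$2 * c$3 - b$3 * c$2)),
     a$1 * (b$3 * c$4 - b$4 * c$3) - a$3 * (b$1 * c$4 - b$4 * c$1) + a$4 * (b$1 * c$3 - b$3 * c$1),
     a$1 * (b$2 * c$4 - b$4 * c$2) - a$2 * (b$1 * c$4 - b$4 * c$1) + a$4 * (b$1 * c$2 - b$2 * c$1),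
     - (a$1 * (b$2 * c$3 - b$3 * c$2) - a$2 * (b$1 * c$3 - b$3 * c$1) + a$3 * (b$1 * c$2 - b$2 * c$1))]"

lemma pinner_pcross: "pinner (pcross a b c) w = det (vector [a, b, c, w])"
  by (simp add: det_4 pcross_def pinner_def algebra_simps)

lemma det_vector_4_swap:
  fixes a b c d :: "real ^ 4"
  shows "det (vector [a, b, d, c]) = - det (vector [a, b, c, d])"
  by (simp add: det_4 algebra_simps)

lemma pinner_pcross_orthogonal:
  "pinner (pcross a b c) a = 0" "pinner (pcross a b c) b = 0" "pinner (pcross a b c) c = 0"
  by (simp_all add: pcross_def pinner_def algebra_simps)

text \<open>Lagrange's identity: the right-hand side is the Gram determinant of \<open>a, b, c\<close>, and it enters
  with sign plus since the ambient metric has determinant 1.\<close>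

lemma pinner_pcross_self:
  "pinner (pcross a b c) (pcross a b c) =
      pinner a a * (pinner b b * pinner c c - pinner b c * pinner b c)
    - pinner a b * (pinner a b * pinner c c - pinner b c * pinner a c)
    + pinner a c * (pinner a b * pinner b c - pinner b b * pinner a c)"
  unfolding pcross_def pinner_def vector_4 by algebra


section \<open>Orthogonal parameters\<close>

locale orthogonal_patch =
  fixes z :: "real \<times> real \<Rightarrow> real ^ 4" and D :: "(real \<times> real) set"
  assumes surface: "lorentz_surface z D"
    and orthogonal: "\<And>p. p \<in> D \<Longrightarrow> F_coeff z p = 0"
begin

lemma E_pos: "p \<in> D \<Longrightarrow> E_coeff z p > 0"
  and G_neg: "p \<in> D \<Longrightarrow> G_coeff z p < 0"
  using surface by (auto simp: lorentz_surface_def)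

lemma pinner_du_dv:
  assumes "p \<in> D"
  shows "pinner (du z p) (du z p) = E_coeff z p" "pinner (dv z p) (dv z p) = G_coeff z p"
    "pinner (du z p) (dv z p) = 0" "pinner (dv z p) (du z p) = 0"
  using orthogonal[OF assms] pinner_commute[of "dv z p" "du z p"]
  by (simp_all add: E_coeff_def F_coeff_def G_coeff_def)

lemma frechet_eq:
  assumes "p \<in> D"
  shows "frechet_derivative z (at p) w = fst w *\<^sub>R du z p + snd w *\<^sub>R dv z p"
  using frechet_derivative_du_dv lorentz_surface_differentiable(1)[OF surface assms] .

lemma tangent_plane_eq:
  assumes "p \<in> D"
  shows "tangent_plane z p = {a *\<^sub>R du z p + b *\<^sub>R dv z p |a b. True}"
proof -
  have "{a *\<^sub>R du z p + b *\<^sub>R dv z p |a b. True} = range (\<lambda>w. fst w *\<^sub>R du z p + snd w *\<^sub>R dv z p)"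
    unfolding image_def by fastforce
  then show ?thesis
    by (simp add: tangent_plane_def frechet_eq[OF assms])
qed

lemma normal_plane_iff:
  assumes "p \<in> D"
  shows "n \<in> normal_plane z p \<longleftrightarrow> pinner n (du z p) = 0 \<and> pinner n (dv z p) = 0"
proof
  assume n: "n \<in> normal_plane z p"
  have "du z p = 1 *\<^sub>R du z p + 0 *\<^sub>R dv z p" "dv z p = 0 *\<^sub>R du z p + 1 *\<^sub>R dv z p" by simp_all
  then have "du z p \<in> tangent_plane z p" "dv z p \<in> tangent_plane z p"
    unfolding tangent_plane_eq[OF assms] by blast+
  then show "pinner n (du z p) = 0 \<and> pinner n (dv z p) = 0"
    using n by (auto simp: normal_plane_def)
next
  assume "pinner n (du z p) = 0 \<and> pinner n (dv z p) = 0"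
  then show "n \<in> normal_plane z p"
    by (auto simp: normal_plane_def tangent_plane_eq[OF assms] pinner.add_right pinner.scaleR_right)
qed

text \<open>As \<open>du z\<close> and \<open>dv z\<close> are orthogonal and not null, the normal part of a vector is obtained by
  removing its component along each of them.\<close>

definition normal_proj :: "real \<times> real \<Rightarrow> real ^ 4 \<Rightarrow> real ^ 4" where
  "normal_proj p v = v - (pinner v (du z p) / E_coeff z p) *\<^sub>R du z p
                       - (pinner v (dv z p) / G_coeff z p) *\<^sub>R dv z p"

lemma normal_proj_add: "normal_proj p (v + w) = normal_proj p v + normal_proj p w"
  by (simp add: normal_proj_def pinner.add_left add_divide_distrib algebra_simps)

lemma normal_proj_scaleR: "normal_proj p (c *\<^sub>R v) = c *\<^sub>R normal_proj p v"
  by (simp add: normal_proj_def pinner.scaleR_left algebra_simps)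

lemma normal_proj_in_normal_plane: "p \<in> D \<Longrightarrow> normal_proj p v \<in> normal_plane z p"
  using E_pos[of p] G_neg[of p]
  by (simp add: normal_plane_iff normal_proj_def pinner.diff_left pinner.scaleR_left pinner_du_dv)

lemma pinner_normal_proj:
  assumes "p \<in> D" "n \<in> normal_plane z p"
  shows "pinner (normal_proj p v) n = pinner v n"
  using assms pinner_commute[of "du z p" n] pinner_commute[of "dv z p" n]
  by (simp add: normal_plane_iff normal_proj_def pinner.diff_left pinner.scaleR_left)

lemma normal_part_eq:
  assumes p: "p \<in> D"
  shows "normal_part z p v = normal_proj p v"
  unfolding normal_part_def
proof (rule the_equality)
  have "v - normal_proj p v = (pinner v (du z p) / E_coeff z p) *\<^sub>R du z p
      + (pinner v (dv z p) / G_coeff z p) *\<^sub>R dv z p"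
    by (simp add: normal_proj_def)
  then show "normal_proj p v \<in> normal_plane z p \<and> v - normal_proj p v \<in> tangent_plane z p"
    using normal_proj_in_normal_plane[OF p] unfolding tangent_plane_eq[OF p] by blast
next
  fix n assume n: "n \<in> normal_plane z p \<and> v - n \<in> tangent_plane z p"
  then obtain a b where ab: "v - n = a *\<^sub>R du z p + b *\<^sub>R dv z p"
    unfolding tangent_plane_eq[OF p] by blast
  then have v: "v = n + (a *\<^sub>R du z p + b *\<^sub>R dv z p)" by (simp add: algebra_simps)
  have "pinner n (du z p) = 0" "pinner n (dv z p) = 0"
    using n normal_plane_iff[OF p] by blast+
  then have "pinner v (du z p) = a * E_coeff z p" "pinner v (dv z p) = b * G_coeff z p"
    by (simp_all add: v pinner.add_left pinner.scaleR_left pinner_du_dv[OF p])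
  then have "normal_proj p v = v - a *\<^sub>R du z p - b *\<^sub>R dv z p"
    using E_pos[OF p] G_neg[OF p] by (simp add: normal_proj_def)
  then show "n = normal_proj p v" by (simp add: v)
qed

text \<open>The coordinate extension of the second argument has constant coefficients \<open>c, d\<close>, so
  differentiating it produces only second derivatives of \<open>z\<close>, whose normal parts then combine
  bilinearly.\<close>

lemma sff_coordinates:
  assumes p: "p \<in> D"
  shows "sff z p (a *\<^sub>R du z p + b *\<^sub>R dv z p) (c *\<^sub>R du z p + d *\<^sub>R dv z p) =
      (a * c) *\<^sub>R normal_proj p (du (du z) p) + (a * d) *\<^sub>R normal_proj p (du (dv z) p)
    + (b * c) *\<^sub>R normal_proj p (dv (du z) p) + (b * d) *\<^sub>R normal_proj p (dv (dv z) p)"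
proof -
  let ?D = "frechet_derivative z (at p)"
  have "inj ?D" using surface p by (auto simp: lorentz_surface_def)
  then have inv: "inv ?D (s *\<^sub>R du z p + t *\<^sub>R dv z p) = (s, t)" for s t
    using inv_f_f[of ?D "(s, t)"] by (simp add: frechet_eq[OF p])
  define Y where "Y = coordinate_extension z p (c *\<^sub>R du z p + d *\<^sub>R dv z p)"
  have op: "open D" using surface by (simp add: lorentz_surface_def)
  note zd = lorentz_surface_differentiable[OF surface p]
  have 1: "(du z has_derivative frechet_derivative (du z) (at p)) (at p)"
    and 2: "(dv z has_derivative frechet_derivative (dv z) (at p)) (at p)"
    using zd frechet_derivative_works by blast+
  have "((\<lambda>q. c *\<^sub>R du z q + d *\<^sub>R dv z q) has_derivative
      (\<lambda>h. c *\<^sub>R frechet_derivative (du z) (at p) h + d *\<^sub>R frechet_derivative (dv z) (at p) h)) (at p)"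
    by (intro has_derivative_add has_derivative_scaleR_right 1 2)
  then have "(Y has_derivative
      (\<lambda>h. c *\<^sub>R frechet_derivative (du z) (at p) h + d *\<^sub>R frechet_derivative (dv z) (at p) h)) (at p)"
    by (rule has_derivative_transform_within_open[OF _ op p])
       (simp add: Y_def coordinate_extension_def inv frechet_eq)
  then have "frechet_derivative Y (at p) =
      (\<lambda>h. c *\<^sub>R frechet_derivative (du z) (at p) h + d *\<^sub>R frechet_derivative (dv z) (at p) h)"
    by (rule frechet_derivative_at[symmetric])
  then have "nabla' z p (a *\<^sub>R du z p + b *\<^sub>R dv z p) Y =
      c *\<^sub>R (a *\<^sub>R du (du z) p + b *\<^sub>R dv (du z) p) + d *\<^sub>R (a *\<^sub>R du (dv z) p + b *\<^sub>R dv (dv z) p)"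
    by (simp add: nabla'_def inv frechet_derivative_du_dv zd)
  then show ?thesis
    unfolding sff_def Y_def[symmetric] normal_part_eq[OF p]
    by (simp add: normal_proj_add normal_proj_scaleR algebra_simps)
qed

lemma frame_products:
  assumes "p \<in> D"
  shows "pinner (frame_x z p) (frame_x z p) = 1" "pinner (frame_y z p) (frame_y z p) = -1"
    "pinner (frame_x z p) (frame_y z p) = 0"
proof -
  have "sqrt (E_coeff z p) * sqrt (E_coeff z p) = E_coeff z p"
    "sqrt (- G_coeff z p) * sqrt (- G_coeff z p) = - G_coeff z p"
    using E_pos[OF assms] G_neg[OF assms] by simp_all
  then show "pinner (frame_x z p) (frame_x z p) = 1" "pinner (frame_y z p) (frame_y z p) = -1"
    "pinner (frame_x z p) (frame_y z p) = 0"
    using E_pos[OF assms] G_neg[OF assms]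
    by (simp_all add: frame_x_def frame_y_def pinner.scaleR_left pinner.scaleR_right
        pinner_du_dv[OF assms] field_simps)
qed

lemma sff_frame:
  assumes p: "p \<in> D"
  shows sff_xx: "sff z p (frame_x z p) (frame_x z p) = (1 / E_coeff z p) *\<^sub>R normal_proj p (du (du z) p)"
    and sff_yy: "sff z p (frame_y z p) (frame_y z p) = (- 1 / G_coeff z p) *\<^sub>R normal_proj p (dv (dv z) p)"
    and sff_xy_normal: "sff z p (frame_x z p) (frame_y z p) \<in> normal_plane z p"
proof -
  have x: "frame_x z p = (1 / sqrt (E_coeff z p)) *\<^sub>R du z p + 0 *\<^sub>R dv z p"
    and y: "frame_y z p = 0 *\<^sub>R du z p + (1 / sqrt (- G_coeff z p)) *\<^sub>R dv z p"
    by (simp_all add: frame_x_def frame_y_def)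
  have sE: "sqrt (E_coeff z p) * sqrt (E_coeff z p) = E_coeff z p"
    and sG: "sqrt (- G_coeff z p) * sqrt (- G_coeff z p) = - G_coeff z p"
    using E_pos[OF p] G_neg[OF p] by simp_all
  have n: "pinner (normal_proj p v) (du z p) = 0" "pinner (normal_proj p v) (dv z p) = 0" for v
    using normal_proj_in_normal_plane[OF p] normal_plane_iff[OF p] by blast+
  show "sff z p (frame_x z p) (frame_x z p) = (1 / E_coeff z p) *\<^sub>R normal_proj p (du (du z) p)"
    unfolding x sff_coordinates[OF p] using E_pos[OF p] by (simp add: sE)
  show "sff z p (frame_y z p) (frame_y z p) = (- 1 / G_coeff z p) *\<^sub>R normal_proj p (dv (dv z) p)"
    unfolding y sff_coordinates[OF p] using G_neg[OF p] by (simp add: sG)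
  show "sff z p (frame_x z p) (frame_y z p) \<in> normal_plane z p"
    unfolding x y sff_coordinates[OF p]
    by (simp add: normal_plane_iff[OF p] pinner.scaleR_left n)
qed

text \<open>The trace does not depend on the orthonormal frame: for \<open>X = a z\<^sub>u + b z\<^sub>v\<close> and
  \<open>Y = c z\<^sub>u + d z\<^sub>v\<close>, the orthonormality relations force \<open>a\<^sup>2 - c\<^sup>2 = 1/E\<close>, \<open>ab - cd = 0\<close> and
  \<open>b\<^sup>2 - d\<^sup>2 = 1/G\<close>, which are the entries of the inverse metric.\<close>

lemma mean_curvature_vector_coordinates:
  assumes p: "p \<in> D"
  shows "mean_curvature_vector z p =
    (1/2) *\<^sub>R ((1 / E_coeff z p) *\<^sub>R normal_proj p (du (du z) p)
             + (1 / G_coeff z p) *\<^sub>R normal_proj p (dv (dv z) p))" (is "_ = ?h")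
  unfolding mean_curvature_vector_def
proof (rule the_equality)
  show "\<forall>X Y. orthonormal_tangent_frame z p X Y \<longrightarrow> ?h = (1/2) *\<^sub>R (sff z p X X - sff z p Y Y)"
  proof (intro allI impI)
    fix X Y assume XY: "orthonormal_tangent_frame z p X Y"
    obtain a b where X: "X = a *\<^sub>R du z p + b *\<^sub>R dv z p"
      using XY unfolding orthonormal_tangent_frame_def tangent_plane_eq[OF p] by blast
    obtain c d where Y: "Y = c *\<^sub>R du z p + d *\<^sub>R dv z p"
      using XY unfolding orthonormal_tangent_frame_def tangent_plane_eq[OF p] by blast
    define e where "e = E_coeff z p"
    define g where "g = G_coeff z p"
    have eg: "e > 0" "g < 0" using E_pos[OF p] G_neg[OF p] by (simp_all add: e_def g_def)
    have XX: "a * a * e + b * b * g = 1" and YY: "c * c * e + d * d * g = -1"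
      and XY0: "a * c * e + b * d * g = 0"
      using XY unfolding orthonormal_tangent_frame_def X Y e_def g_def
      by (simp_all add: pinner.add_left pinner.add_right pinner.scaleR_left pinner.scaleR_right
          pinner_du_dv[OF p] algebra_simps)
    \<comment> \<open>\<open>Y\<close> is timelike and \<open>du z p\<close> is spacelike, so \<open>Y\<close> has a component along \<open>dv z p\<close>\<close>
    have "g * (d * d) \<noteq> 0"
    proof
      assume "g * (d * d) = 0"
      then have "c * c * e = -1" using YY by algebra
      moreover have "c * c * e \<ge> 0" using eg by simp
      ultimately show False by simp
    qed
    then have d: "d \<noteq> 0" by auto
    have "g * d * (a * b - c * d) = 0" using XX YY XY0 by algebra
    then have 1: "a * b - c * d = 0" using d eg by simp
    have 2: "(a * a - c * c) * e = 1" using XX YY XY0 by algebra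
    have 3: "(b * b - d * d) * g = 1" using XX YY 2 by (simp add: algebra_simps)
    have "sff z p X X - sff z p Y Y =
        (a * a - c * c) *\<^sub>R normal_proj p (du (du z) p)
      + (a * b - c * d) *\<^sub>R (normal_proj p (du (dv z) p) + normal_proj p (dv (du z) p))
      + (b * b - d * d) *\<^sub>R normal_proj p (dv (dv z) p)"
      unfolding X Y sff_coordinates[OF p] by (simp add: algebra_simps)
    moreover have "a * a - c * c = 1 / E_coeff z p" "b * b - d * d = 1 / G_coeff z p"
      using 2 3 eg unfolding e_def g_def by (simp_all add: field_simps)
    ultimately show "?h = (1/2) *\<^sub>R (sff z p X X - sff z p Y Y)" by (simp add: 1)
  qed
next
  fix h assume h: "\<forall>X Y. orthonormal_tangent_frame z p X Y \<longrightarrow> h = (1/2) *\<^sub>R (sff z p X X - sff z p Y Y)"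
  have "frame_x z p = (1 / sqrt (E_coeff z p)) *\<^sub>R du z p + 0 *\<^sub>R dv z p"
    and "frame_y z p = 0 *\<^sub>R du z p + (1 / sqrt (- G_coeff z p)) *\<^sub>R dv z p"
    by (simp_all add: frame_x_def frame_y_def)
  then have "orthonormal_tangent_frame z p (frame_x z p) (frame_y z p)"
    unfolding orthonormal_tangent_frame_def tangent_plane_eq[OF p]
    using frame_products[OF p] by blast
  then show "h = ?h" using h sff_xx[OF p] sff_yy[OF p] by simp
qed

lemma mean_curvature_vector_frame:
  assumes p: "p \<in> D"
  shows "mean_curvature_vector z p =
    (1/2) *\<^sub>R (sff z p (frame_x z p) (frame_x z p) - sff z p (frame_y z p) (frame_y z p))"
  by (simp add: mean_curvature_vector_coordinates[OF p] sff_xx[OF p] sff_yy[OF p])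

lemma mean_curvature_normal: "p \<in> D \<Longrightarrow> mean_curvature_vector z p \<in> normal_plane z p"
  by (simp add: mean_curvature_vector_coordinates normal_proj_scaleR[symmetric]
      normal_proj_add[symmetric] normal_proj_in_normal_plane)

section \<open>The geometric frame\<close>

text \<open>The vector \<open>l\<close> is minus the cross product of \<open>x, y, b\<close>: by Lagrange's identity its square is the
  Gram determinant \<open>-\<epsilon>\<close>, and the minus sign makes the orientation right for both values of \<open>\<epsilon>\<close>. It is
  unique because any competitor is a multiple \<open>t l\<close> with \<open>t\<^sup>2 = 1\<close>, and the orientation
  forces \<open>t > 0\<close>.\<close>

lemma frame_b_l:
  assumes p: "p \<in> D"
    and H: "pinner (mean_curvature_vector z p) (mean_curvature_vector z p) \<noteq> 0"
  shows eps_cases: "eps z p = 1 \<or> eps z p = -1"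
    and frame_b_normal: "frame_b z p \<in> normal_plane z p"
    and pinner_b_b: "pinner (frame_b z p) (frame_b z p) = eps z p"
    and frame_l_normal: "frame_l z p \<in> normal_plane z p"
    and pinner_l_l: "pinner (frame_l z p) (frame_l z p) = - eps z p"
    and pinner_b_l: "pinner (frame_b z p) (frame_l z p) = 0"
    and normal_expansion: "\<And>n. n \<in> normal_plane z p \<Longrightarrow>
      n = (eps z p * pinner n (frame_b z p)) *\<^sub>R frame_b z p
        - (eps z p * pinner n (frame_l z p)) *\<^sub>R frame_l z p"
proof -
  let ?H = "mean_curvature_vector z p"
  define e where "e = eps z p"
  define x where "x = frame_x z p"
  define y where "y = frame_y z p"
  define b where "b = frame_b z p"
  have normal_xy: "n \<in> normal_plane z p \<longleftrightarrow> pinner n x = 0 \<and> pinner n y = 0" for n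
    using E_pos[OF p] G_neg[OF p]
    by (simp add: normal_plane_iff[OF p] x_def y_def frame_x_def frame_y_def pinner.scaleR_right)
  have e: "e = 1 \<or> e = -1" using H by (auto simp: e_def eps_def sgn_real_def)
  have pos: "e * pinner ?H ?H > 0" using H by (auto simp: e_def eps_def sgn_real_def)
  have bn: "b \<in> normal_plane z p"
    using mean_curvature_normal[OF p]
    by (simp add: normal_plane_iff[OF p] b_def frame_b_def pinner.scaleR_left)
  have bb: "pinner b b = e"
  proof -
    have "pinner b b = e * e * pinner ?H ?H / (sqrt (e * pinner ?H ?H) * sqrt (e * pinner ?H ?H))"
      by (simp add: b_def frame_b_def pinner.scaleR_left pinner.scaleR_right e_def)
    also have "sqrt (e * pinner ?H ?H) * sqrt (e * pinner ?H ?H) = e * pinner ?H ?H"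
      using pos by simp
    finally show ?thesis using pos by auto
  qed
  define l where "l = - pcross x y b"
  have xx: "pinner x x = 1" "pinner y y = -1" "pinner x y = 0" "pinner x b = 0" "pinner y b = 0"
    using frame_products[OF p] bn normal_xy[of b]
    by (simp_all add: x_def y_def pinner_commute)
  have ln: "l \<in> normal_plane z p"
    by (simp add: normal_xy l_def pinner.minus_left pinner_pcross_orthogonal)
  have bl: "pinner b l = 0"
    by (simp add: l_def pinner.minus_left pinner_pcross_orthogonal pinner_commute[of b])
  have ll: "pinner l l = - e"
    by (simp add: l_def pinner.minus_left pinner.minus_right pinner_pcross_self xx bb)
  have lx: "pinner x l = 0" "pinner y l = 0"
    using ln normal_xy[of l] by (simp_all add: pinner_commute)
  note expansion = pinner_orthonormal_expansion[OF xx(1,2) bb ll xx(3,4) lx(1) xx(5) lx(2) bl e]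
  \<comment> \<open>both orientation conditions become one inequality, since swapping the last two vectors changes
    the sign of the determinant\<close>
  have oriented: "(if e = 1 then positively_oriented x y b n else positively_oriented x y n b)
      \<longleftrightarrow> e * pinner n l < 0" for n
    using e by (auto simp: positively_oriented_def l_def pinner.minus_right
        pinner_commute[of n] pinner_pcross det_vector_4_swap[of x y n b])
  have "frame_l z p = l"
    unfolding frame_l_def e_def[symmetric] x_def[symmetric] y_def[symmetric] b_def[symmetric] oriented
  proof (rule the_equality)
    show "l \<in> normal_plane z p \<and> pinner l l = - e \<and> pinner b l = 0 \<and> e * pinner l l < 0"
      using ln ll bl e by auto
  next
    fix n assume n: "n \<in> normal_plane z p \<and> pinner n n = - e \<and> pinner b n = 0 \<and> e * pinner n l < 0"
    define t where "t = - (e * pinner n l)"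
    have "n = t *\<^sub>R l"
      using expansion[of n] n normal_xy[of n] pinner_commute[of b n] by (simp add: t_def)
    moreover have "t = 1"
    proof -
      have "t * t * pinner l l = - e"
        using n calculation by (simp add: pinner.scaleR_left pinner.scaleR_right)
      then have "t\<^sup>2 = 1" using e by (auto simp: ll power2_eq_square)
      moreover have "t > 0" using n by (simp add: t_def)
      ultimately show ?thesis by (simp add: power2_eq_1_iff)
    qed
    ultimately show "n = l" by simp
  qed
  moreover have "n = (e * pinner n b) *\<^sub>R b - (e * pinner n l) *\<^sub>R l" if "n \<in> normal_plane z p" for n
    using expansion[of n] that normal_xy[of n] by simp
  ultimately show "eps z p = 1 \<or> eps z p = -1" "frame_b z p \<in> normal_plane z p"
    "pinner (frame_b z p) (frame_b z p) = eps z p"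
    "frame_l z p \<in> normal_plane z p"
    "pinner (frame_l z p) (frame_l z p) = - eps z p"
    "pinner (frame_b z p) (frame_l z p) = 0"
    "\<And>n. n \<in> normal_plane z p \<Longrightarrow>
      n = (eps z p * pinner n (frame_b z p)) *\<^sub>R frame_b z p
        - (eps z p * pinner n (frame_l z p)) *\<^sub>R frame_l z p"
    using e bn bb ln ll bl by (simp_all add: e_def b_def)
qed

section \<open>The Gauss curvature in terms of the geometric functions\<close>

text \<open>Up to non-zero factors, \<open>M\<close> is the determinant of the components of \<open>\<sigma>(x,x)\<close> and \<open>\<sigma>(y,y)\<close> in the
  normal frame. This is how principal parameters enter.\<close>

lemma M_coeff_eq_0_iff:
  assumes p: "p \<in> D" and n: "orthonormal_normal_frame z p n1 n2"
  shows "M_coeff z p n1 n2 = 0 \<longleftrightarrow>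
      pinner (sff z p (frame_x z p) (frame_x z p)) n1 * pinner (sff z p (frame_y z p) (frame_y z p)) n2
    = pinner (sff z p (frame_y z p) (frame_y z p)) n1 * pinner (sff z p (frame_x z p) (frame_x z p)) n2"
proof -
  have "W_coeff z p \<noteq> 0"
    using E_pos[OF p] G_neg[OF p] orthogonal[OF p] by (simp add: W_coeff_def)
  then show ?thesis
    using n E_pos[OF p] G_neg[OF p]
    by (simp add: M_coeff_def Delta2_def c11_def c22_def sff_xx[OF p] sff_yy[OF p] orthonormal_normal_frame_def
        pinner.scaleR_left pinner.minus_left pinner_normal_proj[OF p] field_simps)
qed

lemma gauss_curvature_eq:
  assumes p: "p \<in> D"
    and H: "pinner (mean_curvature_vector z p) (mean_curvature_vector z p) \<noteq> 0"
    and M: "\<And>n1 n2. orthonormal_normal_frame z p n1 n2 \<Longrightarrow> M_coeff z p n1 n2 = 0"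
  shows "gauss_curvature z p = eps z p * ((lam z p)\<^sup>2 - (mu z p)\<^sup>2 - nu1 z p * nu2 z p)"
proof -
  let ?H = "mean_curvature_vector z p"
  define e where "e = eps z p"
  define b where "b = frame_b z p"
  define l where "l = frame_l z p"
  define s where "s = sff z p (frame_x z p) (frame_x z p)"
  define t where "t = sff z p (frame_y z p) (frame_y z p)"
  define r where "r = sff z p (frame_x z p) (frame_y z p)"
  note frame = frame_b_l[OF p H, folded e_def b_def l_def]
  have sn: "s \<in> normal_plane z p" and tn: "t \<in> normal_plane z p" and rn: "r \<in> normal_plane z p"
    using sff_xy_normal[OF p] normal_proj_in_normal_plane[OF p]
    by (simp_all add: s_def t_def r_def sff_xx[OF p] sff_yy[OF p] normal_proj_scaleR[symmetric] del: scaleR_minus_left)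
  define \<beta> where "\<beta> = e / sqrt (e * pinner ?H ?H)"
  have b: "b = (\<beta> / 2) *\<^sub>R (s - t)"
    by (simp add: b_def frame_b_def \<beta>_def e_def mean_curvature_vector_frame[OF p] s_def t_def)
  have "\<beta> \<noteq> 0" using frame(1,3) by (auto simp: b pinner.zero_left)
  then have st_l: "pinner s l = pinner t l"
    using frame(6) by (simp add: b pinner.scaleR_left pinner.diff_left)
  have "pinner b b = \<beta> / 2 * (pinner s b - pinner t b)"
    by (subst (1) b) (simp add: pinner.scaleR_left pinner.diff_left)
  then have st_b: "pinner s b \<noteq> pinner t b" using frame(1,3) by auto
  \<comment> \<open>a normal frame lists its spacelike vector first: this is \<open>b\<close> if \<open>e = 1\<close> and \<open>l\<close> otherwise\<close>
  have "pinner s b * pinner t l = pinner t b * pinner s l"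
  proof (cases "e = 1")
    case True
    then have "orthonormal_normal_frame z p b l"
      using frame by (simp add: orthonormal_normal_frame_def)
    from M[OF this] show ?thesis
      unfolding M_coeff_eq_0_iff[OF p \<open>orthonormal_normal_frame z p b l\<close>] by (simp add: s_def t_def)
  next
    case False
    then have "orthonormal_normal_frame z p l b"
      using frame by (simp add: orthonormal_normal_frame_def pinner_commute[of l b])
    from M[OF this] show ?thesis
      unfolding M_coeff_eq_0_iff[OF p \<open>orthonormal_normal_frame z p l b\<close>] by (simp add: s_def t_def mult.commute)
  qed
  then have l0: "pinner s l = 0" "pinner t l = 0" using st_l st_b by auto
  have "pinner s t = pinner s ((e * pinner t b) *\<^sub>R b - (e * pinner t l) *\<^sub>R l)"
    using frame(7)[OF tn] by simp
  also have "\<dots> = e * (pinner s b * pinner t b)"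
    by (simp add: l0 pinner.scaleR_right pinner.diff_right)
  finally have st: "pinner s t = e * (pinner s b * pinner t b)" .
  have "pinner r r = pinner r ((e * pinner r b) *\<^sub>R b - (e * pinner r l) *\<^sub>R l)"
    using frame(7)[OF rn] by simp
  also have "\<dots> = e * ((pinner r b)\<^sup>2 - (pinner r l)\<^sup>2)"
    by (simp add: pinner.diff_right pinner.scaleR_right power2_eq_square algebra_simps)
  finally have rr: "pinner r r = e * ((pinner r b)\<^sup>2 - (pinner r l)\<^sup>2)" .
  have "gauss_curvature z p = pinner r r - pinner s t"
    by (simp add: gauss_curvature_def frame_products[OF p] s_def t_def r_def)
  also have "\<dots> = e * ((pinner r b)\<^sup>2 - (pinner r l)\<^sup>2 - pinner s b * pinner t b)"
    by (simp add: st rr algebra_simps)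
  finally show ?thesis
    by (simp add: e_def lam_def mu_def nu1_def nu2_def r_def s_def t_def b_def l_def)
qed

text \<open>The coordinate formula for \<open>H\<close> involves derivatives of \<open>z\<close> up to order two only, so it is continuous
  on \<open>D\<close>.\<close>

lemma eps_constant:
  assumes H: "\<And>p. p \<in> D \<Longrightarrow> pinner (mean_curvature_vector z p) (mean_curvature_vector z p) \<noteq> 0"
  obtains e where "e = 1 \<or> e = -1" "\<And>p. p \<in> D \<Longrightarrow> eps z p = e"
proof -
  let ?h = "\<lambda>p. pinner (mean_curvature_vector z p) (mean_curvature_vector z p)"
  note pc = pinner.continuous_on
  have C: "Ck_on 0 D f" if "Ck_on (Suc 0) D f" for f :: "real \<times> real \<Rightarrow> real ^ 4"
    using that by (simp add: differentiable_imp_continuous_on differentiable_on_def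
        differentiable_at_withinI)
  have "Ck_on (Suc (Suc 0)) D z" using surface by (simp only: lorentz_surface_def smooth_on_def)
  then have "Ck_on (Suc 0) D (du z)" "Ck_on (Suc 0) D (dv z)" by simp_all
  then have c: "continuous_on D (du z)" "continuous_on D (dv z)"
    "continuous_on D (du (du z))" "continuous_on D (dv (dv z))"
    using C[of "du z"] C[of "dv z"] by simp_all
  have EG: "continuous_on D (E_coeff z)" "continuous_on D (G_coeff z)"
    unfolding E_coeff_def G_coeff_def by (intro pc c)+
  have nz: "\<forall>p\<in>D. E_coeff z p \<noteq> 0" "\<forall>p\<in>D. G_coeff z p \<noteq> 0"
    using E_pos G_neg by fastforce+
  have proj: "continuous_on D (\<lambda>p. normal_proj p (f p))" if "continuous_on D f" for f
    unfolding normal_proj_def by (intro continuous_intros pc c EG that nz)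
  have "continuous_on D (\<lambda>p. (1/2) *\<^sub>R ((1 / E_coeff z p) *\<^sub>R normal_proj p (du (du z) p)
             + (1 / G_coeff z p) *\<^sub>R normal_proj p (dv (dv z) p)))"
    by (intro continuous_intros proj c EG nz)
  then have "continuous_on D (mean_curvature_vector z)"
    by (rule continuous_on_eq) (simp only: mean_curvature_vector_coordinates)
  then have "continuous_on D ?h" by (intro pc)
  moreover have "connected D" using surface by (simp add: lorentz_surface_def)
  ultimately have con: "connected (?h ` D)" by (rule connected_continuous_image)
  have zero: "0 \<notin> ?h ` D" using H by fastforce
  show ?thesis
  proof (cases "\<exists>p\<in>D. ?h p > 0")
    case True
    then obtain p where p: "p \<in> D" "?h p > 0" by blast
    have "?h q > 0" if "q \<in> D" for q
      using connectedD_interval[OF con, of "?h q" "?h p" 0] zero p that by (meson image_eqI less_imp_le linorder_not_le)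
    then show ?thesis by (intro that[of 1]) (auto simp: eps_def)
  next
    case False
    then have "?h q < 0" if "q \<in> D" for q using H[OF that] that by (meson linorder_neqE)
    then show ?thesis by (intro that[of "-1"]) (auto simp: eps_def)
  qed
qed

end

section \<open>Constant Gauss curvature\<close>

theorem proposition5p2:
  fixes z :: "real \<times> real \<Rightarrow> real ^ 4" and D :: "(real \<times> real) set"
  assumes "general_type z D" and "principal_parameters z D"
  shows "gauss_curvature z constant_on D \<longleftrightarrow>
    (\<lambda>p. (lam z p)\<^sup>2 - (mu z p)\<^sup>2 - nu1 z p * nu2 z p) constant_on D"
proof -
  interpret orthogonal_patch z D
    using assms by unfold_locales (auto simp: general_type_def principal_parameters_def)
  have H: "pinner (mean_curvature_vector z p) (mean_curvature_vector z p) \<noteq> 0" if "p \<in> D" for p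
    using assms(1) that unfolding general_type_def by fastforce
  have M: "M_coeff z p n1 n2 = 0" if "p \<in> D" "orthonormal_normal_frame z p n1 n2" for p n1 n2
    using assms(2) that unfolding principal_parameters_def by blast
  let ?f = "\<lambda>p. (lam z p)\<^sup>2 - (mu z p)\<^sup>2 - nu1 z p * nu2 z p"
  obtain e where e: "e = 1 \<or> e = -1" and eps: "\<And>p. p \<in> D \<Longrightarrow> eps z p = e"
    using eps_constant[OF H] by blast
  have K: "gauss_curvature z p = e * ?f p" if "p \<in> D" for p
    using gauss_curvature_eq[OF that H[OF that] M[OF that]] eps[OF that] by simp
  have f: "?f p = e * gauss_curvature z p" if "p \<in> D" for p
    using K[OF that] e by auto
  show ?thesis
  proof
    assume "gauss_curvature z constant_on D"
    then show "?f constant_on D" using f unfolding constant_on_def by metis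
  next
    assume "?f constant_on D"
    then show "gauss_curvature z constant_on D" using K unfolding constant_on_def by metis
  qed
qed

end
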